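(* Let $n\ge 2$, let $G$ be an additively written (not necessarily abelian) group of order $v$, and let $D$ be an $n$-dimensional $(v,k,\lambda)$ difference set in $G$. Then the projection cube $C:G^n\to\{0,1\}$ with $\overline{C}=\operatorname{dev} D$ has an autotopy group isomorphic to $G$, acting sharply transitively on each coordinate.
   Context: A $(v,k,\lambda)$ difference set in $G$ is a subset $D\subseteq G$ of size $k$ such that every $g\in G\setminus\{0\}$ can be written as $g=d_1-d_2$ for exactly $\lambda$ choices of $(d_1,d_2)\in D\times D$. An $n$-dimensional $(v,k,\lambda)$ difference set in $G$ is a set of $n$-tuples $D\subseteq G^n$ of size $k$ such that for all $1\le x<y\le n$ the set $\{d_x-d_y\mid d\in D\}\subseteq G$ is a $(v,k,\lambda)$ difference set in $G$. Its development is $\operatorname{dev} D=\{(d_1+g,\ldots,d_n+g)\mid g\in G,\ d\in D\}\subseteq G^n$. Cubes are indexed by elements of $G$: an $n$-cube is a function $C:G^n\to\{0,1\}$, identified with the subset $\overline{C}=\{(i_1,\ldots,i_n)\in G^n\mid C(i_1,\ldots,i_n)=1\}$. It is a $(v,k,\lambda)$ projection $n$-cube if for all $1\le x<y\le n$ the matrix $\Pi_{xy}(C)$, whose $(i_x,i_y)$-entry is the sum (over a field of characteristic $0$) of $C(i_1,\ldots,i_n)$ over all $n$-tuples with coordinates $i_x,i_y$ fixed, is the incidence matrix of a symmetric $(v,k,\lambda)$ design, i.e. a $\{0,1\}$-matrix $A$ with $AA^t=(k-\lambda)I+\lambda J$, where $I$ is the identity and $J$ the all-ones matrix (and with every column containing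 exactly $k$ ones). The cube $C$ with $\overline{C}=\operatorname{dev}D$ is a $(v,k,\lambda)$ projection $n$-cube. An autotopy of $C$ is an $n$-tuple $(\alpha_1,\ldots,\alpha_n)$ of permutations of the index set $G$ such that $\{(\alpha_1(i_1),\ldots,\alpha_n(i_n))\mid (i_1,\ldots,i_n)\in\overline{C}\}=\overline{C}$. All autotopies of $C$ form a group $\operatorname{Atop}(C)$ under coordinatewise composition; an autotopy group of $C$ is a subgroup of $\operatorname{Atop}(C)$. An autotopy group $H$ acts sharply transitively on each coordinate if for every $j\in\{1,\ldots,n\}$ and all $a,b$ in the index set there is exactly one $(\alpha_1,\ldots,\alpha_n)\in H$ with $\alpha_j(a)=b$. *)

theory Defs
  imports "HOL-Algebra.Algebra"
begin

text \<open>
  The group is a HOL-Algebra group, hence written multiplicatively: \<open>x - y\<close> becomes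
  \<open>x \<otimes> inv y\<close> and \<open>x + g\<close> becomes \<open>x \<otimes> g\<close>, with the order of the operands
  kept since the group need not be abelian.
\<close>

definition difference_set ::
    "nat \<Rightarrow> nat \<Rightarrow> nat \<Rightarrow> ('a, 'm) monoid_scheme \<Rightarrow> 'a set \<Rightarrow> bool" where
  "difference_set v k l G D \<longleftrightarrow>
     order G = v \<and> D \<subseteq> carrier G \<and> card D = k \<and>
     (\<forall>g \<in> carrier G - {\<one>\<^bsub>G\<^esub>}.
        card {(d1, d2) \<in> D \<times> D. g = d1 \<otimes>\<^bsub>G\<^esub> inv\<^bsub>G\<^esub> d2} = l)"

definition tuples :: "nat \<Rightarrow> 'a set \<Rightarrow> (nat \<Rightarrow> 'a) set" where
  "tuples n S = {1..n} \<rightarrow>\<^sub>E S"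

definition ndim_difference_set ::
    "nat \<Rightarrow> nat \<Rightarrow> nat \<Rightarrow> nat \<Rightarrow> ('a, 'm) monoid_scheme \<Rightarrow> (nat \<Rightarrow> 'a) set \<Rightarrow> bool" where
  "ndim_difference_set n v k l G D \<longleftrightarrow>
     D \<subseteq> tuples n (carrier G) \<and> card D = k \<and>
     (\<forall>x \<in> {1..n}. \<forall>y \<in> {1..n}. x < y \<longrightarrow>
        difference_set v k l G {d x \<otimes>\<^bsub>G\<^esub> inv\<^bsub>G\<^esub> (d y) | d. d \<in> D})"

definition dev :: "nat \<Rightarrow> ('a, 'm) monoid_scheme \<Rightarrow> (nat \<Rightarrow> 'a) set \<Rightarrow> (nat \<Rightarrow> 'a) set" where
  "dev n G D = {(\<lambda>j \<in> {1..n}. d j \<otimes>\<^bsub>G\<^esub> g) | g d. g \<in> carrier G \<and> d \<in> D}"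

text \<open>
  Cubes take values in a field of characteristic 0, so that the projection sums are taken there.
  Values outside \<open>tuples n S\<close> are irrelevant.
\<close>

definition is_cube :: "nat \<Rightarrow> 'a set \<Rightarrow> ((nat \<Rightarrow> 'a) \<Rightarrow> 'f::field_char_0) \<Rightarrow> bool" where
  "is_cube n S C \<longleftrightarrow> C \<in> tuples n S \<rightarrow> {0, 1}"

definition cube_support ::
    "nat \<Rightarrow> 'a set \<Rightarrow> ((nat \<Rightarrow> 'a) \<Rightarrow> 'f::field_char_0) \<Rightarrow> (nat \<Rightarrow> 'a) set" where
  "cube_support n S C = {i \<in> tuples n S. C i = 1}"

definition projection ::
    "nat \<Rightarrow> 'a set \<Rightarrow> ((nat \<Rightarrow> 'a) \<Rightarrow> 'f::field_char_0) \<Rightarrow> nat \<Rightarrow> nat \<Rightarrow> 'a \<Rightarrow> 'a \<Rightarrow> 'f" where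
  "projection n S C x y a b = (\<Sum>i \<in> {i \<in> tuples n S. i x = a \<and> i y = b}. C i)"

text \<open>A matrix with rows and columns indexed by \<open>S\<close> is a function of two arguments from \<open>S\<close>.\<close>

definition symmetric_design_matrix ::
    "nat \<Rightarrow> nat \<Rightarrow> nat \<Rightarrow> 'a set \<Rightarrow> ('a \<Rightarrow> 'a \<Rightarrow> 'f::field_char_0) \<Rightarrow> bool" where
  "symmetric_design_matrix v k l S A \<longleftrightarrow>
     finite S \<and> card S = v \<and>
     (\<forall>a \<in> S. \<forall>b \<in> S. A a b \<in> {0, 1}) \<and>
     (\<forall>a \<in> S. \<forall>a' \<in> S.
        (\<Sum>b \<in> S. A a b * A a' b) =
          (of_nat k - of_nat l) * (if a = a' then 1 else 0) + of_nat l) \<and>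
     (\<forall>b \<in> S. card {a \<in> S. A a b = 1} = k)"

definition projection_cube ::
    "nat \<Rightarrow> nat \<Rightarrow> nat \<Rightarrow> nat \<Rightarrow> 'a set \<Rightarrow> ((nat \<Rightarrow> 'a) \<Rightarrow> 'f::field_char_0) \<Rightarrow> bool" where
  "projection_cube n v k l S C \<longleftrightarrow>
     is_cube n S C \<and>
     (\<forall>x \<in> {1..n}. \<forall>y \<in> {1..n}. x < y \<longrightarrow>
        symmetric_design_matrix v k l S (projection n S C x y))"

definition autotopies ::
    "nat \<Rightarrow> 'a set \<Rightarrow> ((nat \<Rightarrow> 'a) \<Rightarrow> 'f::field_char_0) \<Rightarrow> (nat \<Rightarrow> 'a \<Rightarrow> 'a) set" where
  "autotopies n S C =
     {\<alpha> \<in> {1..n} \<rightarrow>\<^sub>E Bij S.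
        (\<lambda>i. \<lambda>j \<in> {1..n}. \<alpha> j (i j)) ` cube_support n S C = cube_support n S C}"

text \<open>Multiplication in the product of the groups \<open>BijGroup S\<close> is coordinatewise composition.\<close>

definition Atop ::
    "nat \<Rightarrow> 'a set \<Rightarrow> ((nat \<Rightarrow> 'a) \<Rightarrow> 'f::field_char_0) \<Rightarrow> (nat \<Rightarrow> 'a \<Rightarrow> 'a) monoid" where
  "Atop n S C = product_group {1..n} (\<lambda>_. BijGroup S) \<lparr>carrier := autotopies n S C\<rparr>"

definition sharply_transitive_on_coordinates ::
    "nat \<Rightarrow> 'a set \<Rightarrow> (nat \<Rightarrow> 'a \<Rightarrow> 'a) set \<Rightarrow> bool" where
  "sharply_transitive_on_coordinates n S H \<longleftrightarrow>
     (\<forall>j \<in> {1..n}. \<forall>a \<in> S. \<forall>b \<in> S. \<exists>!\<alpha>. \<alpha> \<in> H \<and> \<alpha> j a = b)"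

end

theory Submission
  imports Defs
begin

text \<open>
  Two observations about right translation carry the proof.

  Right translation does not change right quotients: \<open>(d x \<otimes> g) \<otimes> inv (d y \<otimes> g) = d x \<otimes> inv (d y)\<close>.
  Let \<open>E\<close> be the set of the quotients \<open>d x \<otimes> inv (d y)\<close> for \<open>d\<close> in \<open>D\<close>. An element of \<open>dev n G D\<close>
  with entries \<open>a\<close>, \<open>b\<close> in positions \<open>x\<close>, \<open>y\<close> can therefore exist only if \<open>a \<otimes> inv b\<close> lies in \<open>E\<close>. If
  \<open>a \<otimes> inv b = d x \<otimes> inv (d y)\<close>, the translate of \<open>d\<close> by \<open>inv (d x) \<otimes> a\<close> is such an element, and the
  only one, because \<open>D\<close> and \<open>E\<close> have the same size: the quotient determines \<open>d\<close>, and \<open>d x\<close>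
  together with \<open>a\<close> determines the translation (lemma \<open>card_dev_fibre\<close>). So the projection onto
  the coordinates \<open>x\<close> and \<open>y\<close> is the characteristic matrix of the relation \<open>a \<otimes> inv b \<in> E\<close>, that is,
  the incidence matrix of the classical development of a difference set, which is a symmetric
  design (lemma \<open>difference_set_design_matrix\<close>).

  Right translation of all coordinates by one group element permutes the translates of each \<open>d\<close>
  among themselves, so it is an autotopy of the cube. Translating by \<open>inv g\<close> instead of \<open>g\<close> turns
  this into a homomorphism from \<open>G\<close> to the product of symmetric groups. Its image is the required
  group of autotopies: on every single coordinate it is the right regular action of \<open>G\<close>, which is
  sharply transitive. As there is at least one coordinate, the homomorphism is also injective.
\<close>

section \<open>Difference sets and symmetric designs\<close>

text \<open>
  Column \<open>b\<close> of the matrix is the translate of \<open>E\<close> by \<open>b\<close>, and row \<open>a\<close> is a translate of the set of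
  inverses of \<open>E\<close>, so both have size \<open>k\<close>. Two distinct rows \<open>a\<close> and \<open>a'\<close> share the entry \<open>b\<close> exactly
  if the pair \<open>(a \<otimes> inv b, a' \<otimes> inv b)\<close> represents \<open>a \<otimes> inv a' \<noteq> \<one>\<close> as a quotient of two elements
  of \<open>E\<close>. Each such representation comes from exactly one \<open>b\<close>, so there are \<open>l\<close> of them.
\<close>
lemma (in group) difference_set_design_matrix:
  fixes A :: "'a \<Rightarrow> 'a \<Rightarrow> 'f::field_char_0"
  assumes fin: "finite (carrier G)" and ds: "difference_set v k l G E"
    and A: "\<And>a b. a \<in> carrier G \<Longrightarrow> b \<in> carrier G \<Longrightarrow> A a b = of_bool (a \<otimes> inv b \<in> E)"
  shows "symmetric_design_matrix v k l (carrier G) A"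
proof -
  have E: "E \<subseteq> carrier G" and cE: "card E = k" and v: "card (carrier G) = v"
    and l: "\<And>g. g \<in> carrier G \<Longrightarrow> g \<noteq> \<one> \<Longrightarrow> card {(d1, d2) \<in> E \<times> E. g = d1 \<otimes> inv d2} = l"
    using ds by (auto simp: difference_set_def order_def)
  have mul: "(\<Sum>b \<in> carrier G. A a b * A a' b)
      = of_nat (card {b \<in> carrier G. a \<otimes> inv b \<in> E \<and> a' \<otimes> inv b \<in> E})"
    if "a \<in> carrier G" "a' \<in> carrier G" for a a'
  proof -
    have "(\<Sum>b \<in> carrier G. A a b * A a' b)
        = (\<Sum>b \<in> carrier G. of_bool (a \<otimes> inv b \<in> E \<and> a' \<otimes> inv b \<in> E))"
      using that by (intro sum.cong) (auto simp: A)
    also have "\<dots> = of_nat (card (carrier G \<inter> {b. a \<otimes> inv b \<in> E \<and> a' \<otimes> inv b \<in> E}))"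
      using fin by simp
    finally show ?thesis by (simp add: Int_def)
  qed
  have row: "card {b \<in> carrier G. a \<otimes> inv b \<in> E} = k" if a: "a \<in> carrier G" for a
  proof -
    have "bij_betw (\<lambda>b. a \<otimes> inv b) {b \<in> carrier G. a \<otimes> inv b \<in> E} E"
    proof (rule bij_betw_byWitness[where f' = "\<lambda>d. inv d \<otimes> a"])
      show "\<forall>b\<in>{b \<in> carrier G. a \<otimes> inv b \<in> E}. inv (a \<otimes> inv b) \<otimes> a = b"
        using a by (auto simp: inv_mult_group m_assoc)
      have recover: "a \<otimes> inv (inv d \<otimes> a) = d" if "d \<in> E" for d
        using a E that by (auto simp: inv_mult_group m_assoc[symmetric] subset_iff)
      then show "\<forall>d\<in>E. a \<otimes> inv (inv d \<otimes> a) = d" by blast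
      show "(\<lambda>d. inv d \<otimes> a) ` E \<subseteq> {b \<in> carrier G. a \<otimes> inv b \<in> E}"
        using a E recover by (auto simp: subset_iff)
    qed auto
    then show ?thesis using cE by (simp add: bij_betw_same_card)
  qed
  have col: "card {a \<in> carrier G. a \<otimes> inv b \<in> E} = k" if b: "b \<in> carrier G" for b
  proof -
    have "bij_betw (\<lambda>a. a \<otimes> inv b) {a \<in> carrier G. a \<otimes> inv b \<in> E} E"
      by (rule bij_betw_byWitness[where f' = "\<lambda>d. d \<otimes> b"])
        (use b E in \<open>auto simp: m_assoc subset_iff\<close>)
    then show ?thesis using cE by (simp add: bij_betw_same_card)
  qed
  have two_rows: "card {b \<in> carrier G. a \<otimes> inv b \<in> E \<and> a' \<otimes> inv b \<in> E} = l"
    if a: "a \<in> carrier G" "a' \<in> carrier G" and ne: "a \<noteq> a'" for a a'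
  proof -
    have ne1: "a \<otimes> inv a' \<noteq> \<one>"
      using a ne by (metis inv_equality inv_inv inv_closed)
    have quot: "a \<otimes> inv b \<otimes> inv (a' \<otimes> inv b) = a \<otimes> inv a'" if "b \<in> carrier G" for b
      using a that by (simp add: inv_mult_group m_assoc) (simp add: m_assoc[symmetric])
    \<comment> \<open>A representation \<open>d1 \<otimes> inv d2\<close> of \<open>a \<otimes> inv a'\<close> can only come from \<open>b = inv d1 \<otimes> a\<close>; taking
      inverses of the representation shows that this \<open>b\<close> also yields \<open>d2\<close>.\<close>
    have recover: "a' \<otimes> inv (inv d1 \<otimes> a) = d2"
      if "a \<otimes> inv a' = d1 \<otimes> inv d2" "d1 \<in> carrier G" "d2 \<in> carrier G" for d1 d2
    proof -
      have "d2 \<otimes> inv d1 = inv (d1 \<otimes> inv d2)"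
        using that by (simp add: inv_mult_group)
      also have "\<dots> = a' \<otimes> inv a"
        using a by (simp add: that(1)[symmetric] inv_mult_group)
      finally have "d2 \<otimes> inv d1 = a' \<otimes> inv a" .
      then show ?thesis
        using a that(2,3)
        by (simp add: inv_mult_group m_assoc[symmetric]) (metis m_assoc l_inv r_one inv_closed)
    qed
    have "bij_betw (\<lambda>b. (a \<otimes> inv b, a' \<otimes> inv b))
        {b \<in> carrier G. a \<otimes> inv b \<in> E \<and> a' \<otimes> inv b \<in> E}
        {(d1, d2) \<in> E \<times> E. a \<otimes> inv a' = d1 \<otimes> inv d2}"
    proof (rule bij_betw_byWitness[where f' = "\<lambda>(d1, d2). inv d1 \<otimes> a"])
      have aa: "a \<otimes> inv (inv d1 \<otimes> a) = d1" if "d1 \<in> carrier G" for d1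
        using a that by (simp add: inv_mult_group m_assoc[symmetric])
      show "\<forall>b\<in>{b \<in> carrier G. a \<otimes> inv b \<in> E \<and> a' \<otimes> inv b \<in> E}.
          (case (a \<otimes> inv b, a' \<otimes> inv b) of (d1, d2) \<Rightarrow> inv d1 \<otimes> a) = b"
        using a by (simp add: inv_mult_group m_assoc)
      show "\<forall>p\<in>{(d1, d2) \<in> E \<times> E. a \<otimes> inv a' = d1 \<otimes> inv d2}.
          (a \<otimes> inv (case p of (d1, d2) \<Rightarrow> inv d1 \<otimes> a), a' \<otimes> inv (case p of (d1, d2) \<Rightarrow> inv d1 \<otimes> a)) = p"
        using E aa recover by (auto simp: subset_iff)
      show "(\<lambda>b. (a \<otimes> inv b, a' \<otimes> inv b)) ` {b \<in> carrier G. a \<otimes> inv b \<in> E \<and> a' \<otimes> inv b \<in> E}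
          \<subseteq> {(d1, d2) \<in> E \<times> E. a \<otimes> inv a' = d1 \<otimes> inv d2}"
        using quot by auto
      show "(\<lambda>(d1, d2). inv d1 \<otimes> a) ` {(d1, d2) \<in> E \<times> E. a \<otimes> inv a' = d1 \<otimes> inv d2}
          \<subseteq> {b \<in> carrier G. a \<otimes> inv b \<in> E \<and> a' \<otimes> inv b \<in> E}"
        using E a aa recover by (auto simp: subset_iff)
    qed
    then show ?thesis
      using l[of "a \<otimes> inv a'"] a ne1 by (simp add: bij_betw_same_card)
  qed
  have col': "card {a \<in> carrier G. A a b = 1} = k" if b: "b \<in> carrier G" for b
  proof -
    have "{a \<in> carrier G. A a b = 1} = {a \<in> carrier G. a \<otimes> inv b \<in> E}"
      using b by (auto simp: A)
    then show ?thesis using col[OF b] by simp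
  qed
  show ?thesis
    unfolding symmetric_design_matrix_def
    using fin v mul row two_rows col' by (auto simp: A)
qed

section \<open>Projections of a development\<close>

text \<open>
  Injectivity is what excludes a second tuple with the same two entries: the quotient of the two entries is invariant
  under translation and hence recovers \<open>d\<close>, after which the translation must be by \<open>inv (d x) \<otimes> a\<close>.
\<close>
lemma (in group) card_dev_fibre:
  assumes D: "D \<subseteq> tuples n (carrier G)" and x: "x \<in> {1..n}" and y: "y \<in> {1..n}"
    and inj: "inj_on (\<lambda>d. d x \<otimes> inv (d y)) D"
    and a: "a \<in> carrier G" and b: "b \<in> carrier G"
  shows "card {i \<in> dev n G D. i x = a \<and> i y = b}
    = of_bool (a \<otimes> inv b \<in> {d x \<otimes> inv (d y) | d. d \<in> D})"
proof -
  have Dc: "d j \<in> carrier G" if "d \<in> D" "j \<in> {1..n}" for d j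
    using D that by (auto simp: tuples_def PiE_iff subset_iff)
  have shape: "\<exists>d\<in>D. a \<otimes> inv b = d x \<otimes> inv (d y) \<and> i = (\<lambda>j\<in>{1..n}. d j \<otimes> (inv (d x) \<otimes> a))"
    if i: "i \<in> dev n G D" "i x = a" "i y = b" for i
  proof -
    obtain g d where g: "g \<in> carrier G" and d: "d \<in> D" and id: "i = (\<lambda>j\<in>{1..n}. d j \<otimes> g)"
      using i(1) by (auto simp: dev_def)
    have ax: "a = d x \<otimes> g" and bx: "b = d y \<otimes> g"
      using i id x y by auto
    have "inv (d x) \<otimes> a = g"
      using ax g Dc[OF d x] by (simp add: m_assoc[symmetric])
    moreover have "a \<otimes> inv b = d x \<otimes> inv (d y)"
      using ax bx g Dc[OF d x] Dc[OF d y]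
      by (simp add: inv_mult_group m_assoc) (simp add: m_assoc[symmetric])
    ultimately show ?thesis using d id by auto
  qed
  show ?thesis
  proof (cases "a \<otimes> inv b \<in> {d x \<otimes> inv (d y) | d. d \<in> D}")
    case True
    then obtain d where d: "d \<in> D" and abd: "a \<otimes> inv b = d x \<otimes> inv (d y)" by auto
    let ?i = "\<lambda>j\<in>{1..n}. d j \<otimes> (inv (d x) \<otimes> a)"
    have "?i x = a"
      using x a Dc[OF d x] by (simp add: m_assoc[symmetric])
    moreover have "?i y = b"
    proof -
      have "inv (d x) \<otimes> a = inv (d x) \<otimes> (a \<otimes> inv b \<otimes> b)"
        using a b Dc[OF d x] by (simp add: m_assoc)
      also have "\<dots> = inv (d y) \<otimes> b"
        unfolding abd using b Dc[OF d x] Dc[OF d y] by (simp add: m_assoc[symmetric])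
      finally show ?thesis
        using y b Dc[OF d y] by (simp add: m_assoc[symmetric])
    qed
    moreover have "?i \<in> dev n G D"
      using d a Dc[OF d x] unfolding dev_def by blast
    moreover have "i = ?i" if "i \<in> dev n G D" "i x = a" "i y = b" for i
      using shape[OF that] abd d inj by (auto simp: inj_on_def)
    ultimately have "{i \<in> dev n G D. i x = a \<and> i y = b} = {?i}" by blast
    then show ?thesis using True by simp
  next
    case False
    then have "{i \<in> dev n G D. i x = a \<and> i y = b} = {}"
      using shape by blast
    then have "card {i \<in> dev n G D. i x = a \<and> i y = b} = 0" by (simp only: card.empty)
    then show ?thesis using False by simp
  qed
qed

lemma projection_eq_card_support:
  fixes C :: "(nat \<Rightarrow> 'a) \<Rightarrow> 'f::field_char_0"
  assumes "finite S" and C: "is_cube n S C"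
  shows "projection n S C x y a b = of_nat (card {i \<in> cube_support n S C. i x = a \<and> i y = b})"
proof -
  have fin: "finite (tuples n S)"
    using assms(1) by (simp add: tuples_def finite_PiE)
  have "projection n S C x y a b = (\<Sum>i \<in> {i \<in> tuples n S. i x = a \<and> i y = b}. of_bool (C i = 1))"
    unfolding projection_def using C by (intro sum.cong) (auto simp: is_cube_def Pi_iff)
  also have "\<dots> = of_nat (card ({i \<in> tuples n S. i x = a \<and> i y = b} \<inter> {i. C i = 1}))"
    using fin by simp
  also have "{i \<in> tuples n S. i x = a \<and> i y = b} \<inter> {i. C i = 1}
      = {i \<in> cube_support n S C. i x = a \<and> i y = b}"
    by (auto simp: cube_support_def)
  finally show ?thesis .
qed

lemma (in group) dev_projection_cube:
  assumes fin: "finite (carrier G)" and D: "ndim_difference_set n v k l G D"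
    and C: "is_cube n (carrier G) C" and supp: "cube_support n (carrier G) C = dev n G D"
  shows "projection_cube n v k l (carrier G) C"
  unfolding projection_cube_def
proof (intro conjI C ballI impI)
  fix x y assume x: "x \<in> {1..n}" and y: "y \<in> {1..n}" and "x < y"
  let ?E = "{d x \<otimes> inv (d y) | d. d \<in> D}"
  have sub: "D \<subseteq> tuples n (carrier G)" and cD: "card D = k" and ds: "difference_set v k l G ?E"
    using D x y \<open>x < y\<close> by (auto simp: ndim_difference_set_def)
  have finD: "finite D"
    using sub fin by (metis finite_subset finite_PiE finite_atLeastAtMost tuples_def)
  have "?E = (\<lambda>d. d x \<otimes> inv (d y)) ` D" by auto
  \<comment> \<open>The two cardinality conditions together force distinct tuples to have distinct differences.\<close>
  then have inj: "inj_on (\<lambda>d. d x \<otimes> inv (d y)) D"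
    using ds cD finD by (intro eq_card_imp_inj_on) (auto simp: difference_set_def)
  show "symmetric_design_matrix v k l (carrier G) (projection n (carrier G) C x y)"
    using fin ds
  proof (rule difference_set_design_matrix)
    fix a b assume "a \<in> carrier G" "b \<in> carrier G"
    then show "projection n (carrier G) C x y a b = of_bool (a \<otimes> inv b \<in> ?E)"
      by (simp only: projection_eq_card_support[OF fin C] supp card_dev_fibre[OF sub x y inj] of_nat_of_bool)
  qed
qed

section \<open>The autotopy group\<close>

lemma BijGroup_simps:
  shows carrier_BijGroup: "carrier (BijGroup S) = Bij S"
    and mult_BijGroup: "f \<in> Bij S \<Longrightarrow> g \<in> Bij S \<Longrightarrow> f \<otimes>\<^bsub>BijGroup S\<^esub> g = compose S f g"
    and one_BijGroup: "\<one>\<^bsub>BijGroup S\<^esub> = (\<lambda>x\<in>S. x)"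
  by (simp_all add: BijGroup_def)

text \<open>
  The product group acts coordinatewise on tuples, hence on sets of tuples. The next two lemmas are
  the two axioms of this action. Only tuples with entries in \<open>S\<close> are moved correctly, since the
  members of \<open>Bij S\<close> all take the value \<open>undefined\<close> outside \<open>S\<close>.
\<close>
lemma coordinate_action_mult:
  assumes "\<alpha> \<in> {1..n} \<rightarrow>\<^sub>E Bij S" "\<beta> \<in> {1..n} \<rightarrow>\<^sub>E Bij S" "T \<subseteq> tuples n S"
  shows "(\<lambda>i. \<lambda>j\<in>{1..n}. (\<alpha> \<otimes>\<^bsub>product_group {1..n} (\<lambda>_. BijGroup S)\<^esub> \<beta>) j (i j)) ` T
    = (\<lambda>i. \<lambda>j\<in>{1..n}. \<alpha> j (i j)) ` (\<lambda>i. \<lambda>j\<in>{1..n}. \<beta> j (i j)) ` T"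
  unfolding image_image
proof (rule image_cong[OF refl])
  fix i assume "i \<in> T"
  then have i: "i j \<in> S" if "j \<in> {1..n}" for j
    using assms(3) that by (auto simp: tuples_def PiE_iff subset_iff)
  show "(\<lambda>j\<in>{1..n}. (\<alpha> \<otimes>\<^bsub>product_group {1..n} (\<lambda>_. BijGroup S)\<^esub> \<beta>) j (i j))
      = (\<lambda>j\<in>{1..n}. \<alpha> j ((\<lambda>j\<in>{1..n}. \<beta> j (i j)) j))"
    using assms(1,2) i by (intro restrict_ext) (auto simp: mult_BijGroup PiE_iff compose_def)
qed

lemma coordinate_action_one:
  assumes "T \<subseteq> tuples n S"
  shows "(\<lambda>i. \<lambda>j\<in>{1..n}. \<one>\<^bsub>product_group {1..n} (\<lambda>_. BijGroup S)\<^esub> j (i j)) ` T = T"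
proof -
  have "(\<lambda>j\<in>{1..n}. \<one>\<^bsub>product_group {1..n} (\<lambda>_. BijGroup S)\<^esub> j (i j)) = i" if "i \<in> T" for i
    using assms that
    by (intro extensionalityI[of _ "{1..n}"]) (auto simp: one_BijGroup tuples_def PiE_iff)
  then show ?thesis by simp
qed

text \<open>
  The autotopies are the stabiliser of the support in this action. That they form a subgroup of
  the full product lets subgroups of \<open>Atop\<close> be obtained as subgroups of the product which happen
  to consist of autotopies.
\<close>
lemma subgroup_autotopies:
  "subgroup (autotopies n S C) (product_group {1..n} (\<lambda>_. BijGroup S))"
proof -
  let ?P = "product_group {1..n} (\<lambda>_. BijGroup S)"
  let ?T = "cube_support n S C"
  interpret P: group ?P
    by (simp add: group_BijGroup)
  have T: "?T \<subseteq> tuples n S" by (auto simp: cube_support_def)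
  have car: "carrier ?P = {1..n} \<rightarrow>\<^sub>E Bij S" by (simp add: carrier_BijGroup)
  have aut: "\<alpha> \<in> autotopies n S C \<longleftrightarrow>
      \<alpha> \<in> carrier ?P \<and> (\<lambda>i. \<lambda>j\<in>{1..n}. \<alpha> j (i j)) ` ?T = ?T" for \<alpha>
    unfolding car by (simp add: autotopies_def)
  have act: "(\<lambda>i. \<lambda>j\<in>{1..n}. (\<alpha> \<otimes>\<^bsub>?P\<^esub> \<beta>) j (i j)) ` ?T
      = (\<lambda>i. \<lambda>j\<in>{1..n}. \<alpha> j (i j)) ` (\<lambda>i. \<lambda>j\<in>{1..n}. \<beta> j (i j)) ` ?T"
    if "\<alpha> \<in> carrier ?P" "\<beta> \<in> carrier ?P" for \<alpha> \<beta>
    using that T unfolding car by (rule coordinate_action_mult)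
  show ?thesis
  proof (rule P.subgroupI)
    show "autotopies n S C \<subseteq> carrier ?P" using aut by blast
    show "autotopies n S C \<noteq> {}"
      using aut[of "\<one>\<^bsub>?P\<^esub>"] P.one_closed coordinate_action_one[OF T] by blast
  next
    fix \<alpha> assume a: "\<alpha> \<in> autotopies n S C"
    then have c: "\<alpha> \<in> carrier ?P" and fix_T: "(\<lambda>i. \<lambda>j\<in>{1..n}. \<alpha> j (i j)) ` ?T = ?T"
      using aut by blast+
    have "(\<lambda>i. \<lambda>j\<in>{1..n}. (inv\<^bsub>?P\<^esub> \<alpha>) j (i j)) ` ?T
        = (\<lambda>i. \<lambda>j\<in>{1..n}. (inv\<^bsub>?P\<^esub> \<alpha> \<otimes>\<^bsub>?P\<^esub> \<alpha>) j (i j)) ` ?T"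
      unfolding act[OF P.inv_closed[OF c] c] fix_T ..
    also have "\<dots> = ?T"
      unfolding P.l_inv[OF c] by (rule coordinate_action_one[OF T])
    finally show "inv\<^bsub>?P\<^esub> \<alpha> \<in> autotopies n S C"
      by (intro iffD2[OF aut] conjI P.inv_closed[OF c])
  next
    fix \<alpha> \<beta> assume "\<alpha> \<in> autotopies n S C" "\<beta> \<in> autotopies n S C"
    then have c: "\<alpha> \<in> carrier ?P" "\<beta> \<in> carrier ?P"
      and fix_T: "(\<lambda>i. \<lambda>j\<in>{1..n}. \<alpha> j (i j)) ` ?T = ?T" "(\<lambda>i. \<lambda>j\<in>{1..n}. \<beta> j (i j)) ` ?T = ?T"
      using aut by blast+
    have "(\<lambda>i. \<lambda>j\<in>{1..n}. (\<alpha> \<otimes>\<^bsub>?P\<^esub> \<beta>) j (i j)) ` ?T = ?T"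
      unfolding act[OF c] fix_T ..
    then show "\<alpha> \<otimes>\<^bsub>?P\<^esub> \<beta> \<in> autotopies n S C"
      by (intro iffD2[OF aut] conjI P.m_closed[OF c])
  qed
qed

text \<open>
  The inverse makes the map multiplicative in \<open>g\<close>: right multiplication by \<open>g\<close> itself would reverse
  the order of products.
\<close>
definition translation :: "nat \<Rightarrow> ('a, 'm) monoid_scheme \<Rightarrow> 'a \<Rightarrow> nat \<Rightarrow> 'a \<Rightarrow> 'a" where
  "translation n G g = (\<lambda>j\<in>{1..n}. \<lambda>x\<in>carrier G. x \<otimes>\<^bsub>G\<^esub> inv\<^bsub>G\<^esub> g)"

lemma (in group) right_translation_Bij:
  assumes "g \<in> carrier G"
  shows "(\<lambda>x\<in>carrier G. x \<otimes> inv g) \<in> Bij (carrier G)"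
proof -
  have "bij_betw (\<lambda>x. x \<otimes> inv g) (carrier G) (carrier G)"
    by (rule bij_betw_byWitness[where f' = "\<lambda>x. x \<otimes> g"]) (use assms in \<open>auto simp: m_assoc\<close>)
  then show ?thesis by (simp add: Bij_def)
qed

lemma (in group) translation_hom:
  "translation n G \<in> hom G (product_group {1..n} (\<lambda>_. BijGroup (carrier G)))"
proof (rule homI)
  fix g h assume g: "g \<in> carrier G" and h: "h \<in> carrier G"
  have "(\<lambda>x\<in>carrier G. x \<otimes> inv (g \<otimes> h))
      = compose (carrier G) (\<lambda>x\<in>carrier G. x \<otimes> inv g) (\<lambda>x\<in>carrier G. x \<otimes> inv h)"
    using g h by (auto simp: compose_def inv_mult_group m_assoc intro!: restrict_ext)
  then show "translation n G (g \<otimes> h)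
      = translation n G g \<otimes>\<^bsub>product_group {1..n} (\<lambda>_. BijGroup (carrier G))\<^esub> translation n G h"
    using g h right_translation_Bij by (auto simp: translation_def mult_BijGroup intro!: restrict_ext)
qed (auto simp: translation_def carrier_BijGroup right_translation_Bij)

text \<open>
  The translate of \<open>d\<close> by \<open>h\<close> is sent to the translate of the same \<open>d\<close> by \<open>h \<otimes> inv g\<close>, and the map
  \<open>h \<mapsto> h \<otimes> inv g\<close> is onto the group.
\<close>
lemma (in group) translation_autotopy:
  assumes g: "g \<in> carrier G" and D: "D \<subseteq> tuples n (carrier G)"
    and supp: "cube_support n (carrier G) C = dev n G D"
  shows "translation n G g \<in> autotopies n (carrier G) C"
proof -
  have Dc: "d j \<in> carrier G" if "d \<in> D" "j \<in> {1..n}" for d j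
    using D that by (auto simp: tuples_def PiE_iff subset_iff)
  have shift: "(\<lambda>j\<in>{1..n}. translation n G g j ((\<lambda>j\<in>{1..n}. d j \<otimes> h) j))
      = (\<lambda>j\<in>{1..n}. d j \<otimes> (h \<otimes> inv g))" if "d \<in> D" "h \<in> carrier G" for d h
    using that g Dc by (intro restrict_ext) (auto simp: translation_def m_assoc)
  have "(\<lambda>i. \<lambda>j\<in>{1..n}. translation n G g j (i j)) ` dev n G D = dev n G D"
  proof (intro equalityI subsetI)
    fix i assume "i \<in> (\<lambda>i. \<lambda>j\<in>{1..n}. translation n G g j (i j)) ` dev n G D"
    then obtain d h where "d \<in> D" "h \<in> carrier G"
      "i = (\<lambda>j\<in>{1..n}. translation n G g j ((\<lambda>j\<in>{1..n}. d j \<otimes> h) j))"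
      by (auto simp only: dev_def)
    then show "i \<in> dev n G D"
      unfolding dev_def using g shift by blast
  next
    fix i assume "i \<in> dev n G D"
    then obtain d h where d: "d \<in> D" and h: "h \<in> carrier G" and i: "i = (\<lambda>j\<in>{1..n}. d j \<otimes> h)"
      by (auto simp: dev_def)
    have hg: "h \<otimes> g \<in> carrier G" and "h \<otimes> g \<otimes> inv g = h"
      using g h by (auto simp: m_assoc)
    then have "i = (\<lambda>j\<in>{1..n}. translation n G g j ((\<lambda>j\<in>{1..n}. d j \<otimes> (h \<otimes> g)) j))"
      using shift[OF d hg] i by simp
    moreover have "(\<lambda>j\<in>{1..n}. d j \<otimes> (h \<otimes> g)) \<in> dev n G D"
      unfolding dev_def using d hg by blast
    ultimately show "i \<in> (\<lambda>i. \<lambda>j\<in>{1..n}. translation n G g j (i j)) ` dev n G D"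
      by (rule image_eqI)
  qed
  moreover have "translation n G g \<in> {1..n} \<rightarrow>\<^sub>E Bij (carrier G)"
    using g right_translation_Bij by (auto simp: translation_def)
  ultimately show ?thesis by (simp add: autotopies_def supp)
qed

text \<open>
  This one equivalence yields both the sharp transitivity on each coordinate and, with
  \<open>a = \<one>\<close>, the injectivity of the translation homomorphism.
\<close>
lemma (in group) translation_apply_eq_iff:
  assumes "g \<in> carrier G" "a \<in> carrier G" "b \<in> carrier G" "j \<in> {1..n}"
  shows "translation n G g j a = b \<longleftrightarrow> g = inv b \<otimes> a"
proof -
  have "translation n G g j a = a \<otimes> inv g" using assms by (simp add: translation_def)
  moreover have "a \<otimes> inv g = b \<longleftrightarrow> g = inv b \<otimes> a"
    using assms by (metis inv_solve_left inv_solve_right' inv_closed)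
  ultimately show ?thesis by simp
qed

theorem proposition3p5:
  fixes G :: "('a, 'm) monoid_scheme"
    and D :: "(nat \<Rightarrow> 'a) set"
    and C :: "(nat \<Rightarrow> 'a) \<Rightarrow> 'f::field_char_0"
    and n v k l :: nat
  assumes "n \<ge> 2"
    and "group G" and "finite (carrier G)" and "order G = v"
    and "ndim_difference_set n v k l G D"
    and "is_cube n (carrier G) C"
    and "cube_support n (carrier G) C = dev n G D"
  shows "projection_cube n v k l (carrier G) C \<and>
    (\<exists>H. subgroup H (Atop n (carrier G) C) \<and>
         (Atop n (carrier G) C)\<lparr>carrier := H\<rparr> \<cong> G \<and>
         sharply_transitive_on_coordinates n (carrier G) H)"
proof (intro conjI exI)
  interpret group G by fact
  let ?P = "product_group {1..n} (\<lambda>_. BijGroup (carrier G))"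
  let ?H = "translation n G ` carrier G"
  show "projection_cube n v k l (carrier G) C"
    using assms(3,5,6,7) by (rule dev_projection_cube)
  have D: "D \<subseteq> tuples n (carrier G)"
    using assms(5) by (simp add: ndim_difference_set_def)
  interpret P: group ?P by (simp add: group_BijGroup)
  interpret \<tau>: group_hom G ?P "translation n G"
    by unfold_locales (rule translation_hom)
  have H_aut: "?H \<subseteq> autotopies n (carrier G) C"
    using translation_autotopy[OF _ D assms(7)] by blast
  show "subgroup ?H (Atop n (carrier G) C)"
    unfolding Atop_def
    using \<tau>.img_is_subgroup subgroup_autotopies H_aut by (rule P.subgroup_incl)
  have inj: "inj_on (translation n G) (carrier G)"
  proof (rule inj_onI)
    fix g h assume "g \<in> carrier G" "h \<in> carrier G" "translation n G g = translation n G h"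
    then show "g = h"
      using translation_apply_eq_iff[of g "\<one>\<^bsub>G\<^esub>" "translation n G g 1 \<one>\<^bsub>G\<^esub>" 1 n]
        translation_apply_eq_iff[of h "\<one>\<^bsub>G\<^esub>" "translation n G g 1 \<one>\<^bsub>G\<^esub>" 1 n] \<open>n \<ge> 2\<close>
      by (simp add: translation_def)
  qed
  have "translation n G \<in> iso G (?P\<lparr>carrier := ?H\<rparr>)"
    using translation_hom inj by (auto simp: iso_def hom_def bij_betw_def)
  then have "G \<cong> (Atop n (carrier G) C)\<lparr>carrier := ?H\<rparr>"
    by (auto simp: is_iso_def Atop_def)
  then show "(Atop n (carrier G) C)\<lparr>carrier := ?H\<rparr> \<cong> G"
    by (rule iso_sym)
  show "sharply_transitive_on_coordinates n (carrier G) ?H"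
    unfolding sharply_transitive_on_coordinates_def
  proof (intro ballI)
    fix j a b assume jab: "j \<in> {1..n}" "a \<in> carrier G" "b \<in> carrier G"
    let ?g = "inv\<^bsub>G\<^esub> b \<otimes>\<^bsub>G\<^esub> a"
    have sol: "translation n G g j a = b \<longleftrightarrow> g = ?g" if "g \<in> carrier G" for g
      using that jab(2,3,1) by (rule translation_apply_eq_iff)
    have g: "?g \<in> carrier G" using jab by simp
    show "\<exists>!\<alpha>. \<alpha> \<in> ?H \<and> \<alpha> j a = b"
    proof (rule ex1I[of _ "translation n G ?g"])
      show "translation n G ?g \<in> ?H \<and> translation n G ?g j a = b"
        using sol[OF g] imageI[OF g] by (intro conjI) simp_all
    next
      fix \<alpha> assume "\<alpha> \<in> ?H \<and> \<alpha> j a = b"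
      then obtain h where "h \<in> carrier G" "\<alpha> = translation n G h" "translation n G h j a = b"
        by (elim conjE imageE) metis
      then show "\<alpha> = translation n G ?g"
        using sol by metis
    qed
  qed
qed

end
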